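(* Let $K\subset\mathbb{C}$ be a convex domain whose boundary curve $\Gamma=\partial K$ is $C^2$-smooth, and suppose that there is a constant $\kappa>0$ such that the curvature of $\Gamma$ satisfies $\kappa(\zeta)\ge\kappa$ at all points $\zeta\in\Gamma$. Then for every positive integer $n$, $$M_n(K)\ \ge\ \frac{\kappa}{2}\,n .$$
   Context: A convex domain is a compact, convex subset of $\mathbb{C}\cong\mathbb{R}^2$ with nonempty interior. For a polynomial $q$ with complex coefficients, $\|q\|:=\|q\|_K:=\max_{z\in K}|q(z)|$. For a positive integer $n$, $\mathcal{P}_n(K)$ denotes the set of complex polynomials of degree exactly $n$ all of whose $n$ complex zeros lie in $K$. The inverse Markov factor of $K$ is $$M_n(K):=\inf_{p\in\mathcal{P}_n(K)}\frac{\|p'\|_K}{\|p\|_K}.$$ The curvature $\kappa(\zeta)$ of $\Gamma$ at $\zeta=\gamma(s)$ is the derivative, with respect to arc length $s$, of the tangent angle of the positively oriented arc-length parametrization $\gamma$ of $\Gamma$; equivalently $\kappa(\zeta)=|\ddot\gamma(s)|$. *)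

theory Defs
  imports "HOL-Complex_Analysis.Complex_Analysis"
begin

definition convex_domain :: "complex set \<Rightarrow> bool" where
  "convex_domain K \<longleftrightarrow> compact K \<and> convex K \<and> interior K \<noteq> {}"

(* For nonempty compact K the supremum is attained, so this is the maximum of |q| on K. *)
definition poly_norm :: "complex set \<Rightarrow> complex poly \<Rightarrow> real" where
  "poly_norm K q = (SUP z\<in>K. norm (poly q z))"

definition polys_zeros_in :: "nat \<Rightarrow> complex set \<Rightarrow> complex poly set" where
  "polys_zeros_in n K = {p. p \<noteq> 0 \<and> degree p = n \<and> (\<forall>z. poly p z = 0 \<longrightarrow> z \<in> K)}"

(* The infimum is over a set of nonnegative reals. It is nonempty when K is (take powers of
   X - a with a in K), and no denominator vanishes when K is infinite and compact. *)
definition inverse_markov :: "nat \<Rightarrow> complex set \<Rightarrow> real" where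
  "inverse_markov n K =
     (INF p\<in>polys_zeros_in n K. poly_norm K (pderiv p) / poly_norm K p)"

(* A closed curve of length L is an L-periodic map on the whole real line, so that smoothness
   also covers the point where the curve closes up. *)
definition positive_arc_length_param :: "complex set \<Rightarrow> real \<Rightarrow> (real \<Rightarrow> complex) \<Rightarrow> bool" where
  "positive_arc_length_param K L \<gamma> \<longleftrightarrow>
     L > 0 \<and> (\<forall>s. \<gamma> (s + L) = \<gamma> s) \<and> inj_on \<gamma> {0..<L} \<and> range \<gamma> = frontier K \<and>
     (\<forall>s. \<gamma> differentiable (at s) \<and> norm (vector_derivative \<gamma> (at s)) = 1) \<and>
     (\<forall>z\<in>interior K. winding_number (\<lambda>t. \<gamma> (L * t)) z = 1)"

definition C2_curve :: "(real \<Rightarrow> complex) \<Rightarrow> bool" where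
  "C2_curve \<gamma> \<longleftrightarrow>
     \<gamma> C1_differentiable_on UNIV \<and>
     (\<lambda>s. vector_derivative \<gamma> (at s)) C1_differentiable_on UNIV"

definition is_tangent_angle :: "(real \<Rightarrow> complex) \<Rightarrow> (real \<Rightarrow> real) \<Rightarrow> bool" where
  "is_tangent_angle \<gamma> \<theta> \<longleftrightarrow>
     continuous_on UNIV \<theta> \<and> (\<forall>s. vector_derivative \<gamma> (at s) = cis (\<theta> s))"

(* A continuous tangent angle of a unit-speed C2 curve exists and is unique up to an additive
   constant, so the choice does not affect the derivative. *)
definition curvature :: "(real \<Rightarrow> complex) \<Rightarrow> real \<Rightarrow> real" where
  "curvature \<gamma> s = deriv (SOME \<theta>. is_tangent_angle \<gamma> \<theta>) s"

end

theory Submission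
  imports Defs "HOL-Computational_Algebra.Fundamental_Theorem_Algebra"
begin

text \<open>
  Let \<open>\<theta>\<close> be the tangent angle, \<open>N s = - \<i> cis (\<theta> s)\<close> and \<open>R = 1 / \<kappa>\<close>. The point \<open>\<gamma> t - R N t\<close> has
  velocity \<open>(1 - R \<theta>' t) cis (\<theta> t)\<close>, a nonpositive multiple of the tangent. Projecting onto \<open>N s\<close>
  with \<open>\<bar>\<theta> s - \<theta> t\<bar> \<le> \<pi>\<close> bounds the support function of \<open>K\<close> by that of the disc of radius \<open>R\<close>
  tangent to \<open>K\<close> at \<open>\<gamma> t\<close>. Since \<open>\<theta>\<close> is onto the reals, every direction is reached, so the disc
  contains \<open>K\<close> (Blaschke's rolling theorem), without any appeal to the total turning number.
  Each zero \<open>a\<close> of \<open>p\<close> then satisfies \<open>Re (N / (\<zeta> - a)) \<ge> 1 / (2 R)\<close> at a boundary point \<open>\<zeta>\<close>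
  where \<open>\<bar>p\<bar>\<close> is maximal, and summing over the zeros bounds \<open>\<bar>p' / p\<bar>\<close> at \<open>\<zeta>\<close>, as in Turan's theorem.
\<close>

section \<open>The tangent angle\<close>

text \<open>A continuous nowhere vanishing function on the contractible real line has a continuous
  logarithm; unit speed makes that logarithm purely imaginary.\<close>

lemma tangent_angle_exists:
  assumes "C2_curve \<gamma>" and "\<And>s. norm (vector_derivative \<gamma> (at s)) = 1"
  shows "\<exists>\<theta>. is_tangent_angle \<gamma> \<theta>"
proof -
  let ?T = "\<lambda>s. vector_derivative \<gamma> (at s)"
  have cont: "continuous_on UNIV ?T"
    using assms(1) unfolding C2_curve_def by (blast intro: C1_differentiable_imp_continuous_on)
  have nz: "?T s \<noteq> 0" for s
    using assms(2)[of s] by (metis norm_zero zero_neq_one)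
  obtain g where g: "continuous_on UNIV g" "\<And>s. ?T s = exp (g s)"
    using continuous_logarithm_on_contractible[OF cont] nz convex_imp_contractible[OF convex_UNIV]
    by (metis UNIV_I)
  have "Re (g s) = 0" for s
    using assms(2)[of s] g(2)[of s] by simp
  then have "?T s = cis (Im (g s))" for s
    using g(2)[of s] by (simp add: exp_eq_polar)
  moreover have "continuous_on UNIV (\<lambda>s. Im (g s))"
    using g(1) by (intro continuous_intros)
  ultimately show ?thesis
    unfolding is_tangent_angle_def by blast
qed

text \<open>Near \<open>s\<close> the angle is recovered as
  \<open>\<theta> s + Im (Ln (g t))\<close>. Dividing by \<open>cis (\<theta> s)\<close> moves the
  base value to 1, away from the branch cut, and continuity keeps the angle difference below
  \<open>pi\<close> in modulus, where \<open>Ln\<close> inverts \<open>exp\<close>.\<close>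

lemma continuous_angle_differentiable:
  fixes \<theta> :: "real \<Rightarrow> real"
  assumes cont: "isCont \<theta> s" and diff: "(\<lambda>t. cis (\<theta> t)) differentiable (at s)"
  shows "\<theta> differentiable (at s)"
proof -
  define g where "g = (\<lambda>t. cis (\<theta> t) / cis (\<theta> s))"
  have "(\<lambda>t. cis (\<theta> t) * inverse (cis (\<theta> s))) differentiable (at s)"
    using diff by (intro derivative_intros)
  then have "g differentiable (at s)"
    by (simp add: g_def divide_inverse)
  then obtain D where D: "(g has_vector_derivative D) (at s)"
    by (meson vector_derivative_works)
  have gs: "g s = 1" by (simp add: g_def)
  have "(Ln has_field_derivative inverse (g s)) (at (g s))"
    by (rule has_field_derivative_Ln) (simp add: gs complex_nonpos_Reals_iff)
  then have "((Ln \<circ> g) has_vector_derivative (D * inverse (g s))) (at s)"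
    using field_vector_diff_chain_at[OF D] by blast
  then have "((\<lambda>t. Im ((Ln \<circ> g) t)) has_vector_derivative Im (D * inverse (g s))) (at s)"
    by (rule bounded_linear.has_vector_derivative[OF bounded_linear_Im])
  then have "((\<lambda>t. \<theta> s + Im (Ln (g t))) has_real_derivative 0 + Im (D * inverse (g s))) (at s)"
    unfolding o_def has_real_derivative_iff_has_vector_derivative[symmetric]
    by (intro DERIV_add DERIV_const)
  moreover have "\<forall>\<^sub>F t in nhds s. \<theta> s + Im (Ln (g t)) = \<theta> t"
  proof -
    have "\<forall>\<^sub>F t in nhds s. dist (\<theta> t) (\<theta> s) < pi"
      by (intro tendstoD) (simp_all add: cont[unfolded isCont_def tendsto_at_iff_tendsto_nhds])
    then show ?thesis
    proof eventually_elim
      case (elim t)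
      have "g t = exp (\<i> * (\<theta> t - \<theta> s))"
        by (simp add: g_def cis_conv_exp right_diff_distrib exp_diff)
      moreover have "Ln (exp (\<i> * (\<theta> t - \<theta> s))) = \<i> * (\<theta> t - \<theta> s)"
        using elim by (intro Ln_exp) (auto simp: dist_real_def)
      ultimately show ?case by simp
    qed
  qed
  ultimately have "(\<theta> has_real_derivative 0 + Im (D * inverse (g s))) (at s)"
    by (subst (asm) DERIV_cong_ev[OF refl _ refl])
  then show ?thesis
    using real_differentiable_def by blast
qed

text \<open>\<open>curvature\<close> is the \<open>deriv\<close> of an angle picked by
  \<open>SOME\<close>. Existence and differentiability of that angle make the value a genuine
  derivative.\<close>

lemma tangent_angle_with_curvature:
  assumes "C2_curve \<gamma>" and "\<And>s. norm (vector_derivative \<gamma> (at s)) = 1"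
  obtains \<theta> where "\<And>s. (\<gamma> has_vector_derivative cis (\<theta> s)) (at s)"
    and "\<And>s. (\<theta> has_real_derivative curvature \<gamma> s) (at s)"
proof
  define \<theta> where "\<theta> = (SOME \<theta>. is_tangent_angle \<gamma> \<theta>)"
  have "is_tangent_angle \<gamma> \<theta>"
    unfolding \<theta>_def using tangent_angle_exists[OF assms] by (rule someI_ex)
  then have cont: "continuous_on UNIV \<theta>" and T: "\<And>s. vector_derivative \<gamma> (at s) = cis (\<theta> s)"
    by (auto simp: is_tangent_angle_def)
  show "(\<gamma> has_vector_derivative cis (\<theta> s)) (at s)" for s
    using assms(1) unfolding T[symmetric] C2_curve_def C1_differentiable_on_eq
    by (simp add: vector_derivative_works)
  have "(\<lambda>s. cis (\<theta> s)) differentiable (at s)" for s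
    using assms(1) unfolding C2_curve_def C1_differentiable_on_eq T by simp
  then have "\<theta> differentiable (at s)" for s
    using continuous_angle_differentiable cont continuous_on_eq_continuous_at[OF open_UNIV]
    by blast
  then show "(\<theta> has_real_derivative curvature \<gamma> s) (at s)" for s
    unfolding curvature_def \<theta>_def[symmetric]
    by (simp add: DERIV_deriv_iff_real_differentiable)
qed

section \<open>The rolling theorem\<close>

lemma inner_cis_normal: "inner (cis x) (- \<i> * cis y) = sin (y - x)"
  by (simp add: inner_complex_def sin_diff)

lemma has_real_derivative_inner_const:
  assumes "(f has_vector_derivative D) F"
  shows "((\<lambda>t. inner (f t) u) has_real_derivative inner D u) F"
  unfolding has_real_derivative_iff_has_vector_derivative
  by (rule bounded_linear.has_vector_derivative[OF bounded_linear_inner_left assms])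

text \<open>The sign of \<open>\<theta>'\<close> carries the orientation:
  \<open>supporting_line\<close> derives from it on which side of each tangent line \<open>K\<close>
  lies.\<close>

locale strictly_curved =
  fixes K :: "complex set" and \<gamma> :: "real \<Rightarrow> complex" and \<theta> \<theta>' :: "real \<Rightarrow> real" and \<kappa> :: real
  assumes convex: "convex K"
    and closed: "closed K"
    and nonempty_interior: "interior K \<noteq> {}"
    and curve: "range \<gamma> = frontier K"
    and tangent: "\<And>s. (\<gamma> has_vector_derivative cis (\<theta> s)) (at s)"
    and angle: "\<And>s. (\<theta> has_real_derivative \<theta>' s) (at s)"
    and pos: "\<kappa> > 0"
    and bound: "\<And>s. \<theta>' s \<ge> \<kappa>"
begin

text \<open>The tangent turned clockwise by a right angle; by \<open>supporting_line\<close> it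
  points out of \<open>K\<close>.\<close>

abbreviation normal :: "real \<Rightarrow> complex" where
  "normal s \<equiv> - \<i> * cis (\<theta> s)"

lemma curve_in: "\<gamma> s \<in> K"
  using curve closed frontier_subset_eq by blast

lemma inner_normal_derivative:
  "((\<lambda>x. inner (\<gamma> x) (normal s)) has_real_derivative sin (\<theta> s - \<theta> x)) (at x)"
  using has_real_derivative_inner_const[OF tangent] unfolding inner_cis_normal[symmetric] .

lemma strict_mono_angle: "strict_mono \<theta>"
  by (rule strict_monoI) (metis DERIV_pos_imp_increasing angle bound order_less_le_trans pos)

lemma continuous_angle: "isCont \<theta> s"
  using angle DERIV_isCont by blast

lemma angle_growth:
  assumes "s \<le> t"
  shows "\<kappa> * (t - s) \<le> \<theta> t - \<theta> s"
proof -
  have "\<theta> s - \<kappa> * s \<le> \<theta> t - \<kappa> * t"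
  proof (rule DERIV_nonneg_imp_nondecreasing[OF assms])
    fix x
    have "((\<lambda>t. \<theta> t - \<kappa> * t) has_real_derivative \<theta>' x - \<kappa>) (at x)"
      by (auto intro!: derivative_eq_intros angle)
    then show "\<exists>y. ((\<lambda>t. \<theta> t - \<kappa> * t) has_real_derivative y) (at x) \<and> 0 \<le> y"
      using bound by force
  qed
  then show ?thesis by (simp add: algebra_simps)
qed

lemma angle_surj: "\<exists>s. \<theta> s = x"
proof -
  \<comment> \<open>Chosen so that linear growth of the angle brackets \<open>x\<close> between
    \<open>\<theta> (- r)\<close> and \<open>\<theta> r\<close>.\<close>
  define r where "r = \<bar>x - \<theta> 0\<bar> / \<kappa>"
  have r: "r \<ge> 0" "\<kappa> * r = \<bar>x - \<theta> 0\<bar>"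
    using pos by (auto simp: r_def)
  have "\<theta> (- r) \<le> x" "x \<le> \<theta> r"
    using angle_growth[of "- r" 0] angle_growth[of 0 r] r by auto
  then show ?thesis
    using IVT[of \<theta> "- r" x r] continuous_angle r(1) by force
qed

text \<open>Positive curvature fixes the side of the tangent line: \<open>\<gamma>\<close> stays strictly to the left of the
  tangent at \<open>s\<close> until the angle has grown by \<open>\<pi>\<close>.\<close>

lemma supporting_line:
  assumes "a \<in> K"
  shows "inner (a - \<gamma> s) (normal s) \<le> 0"
proof -
  have "\<gamma> s \<in> frontier K" using curve by blast
  then have "\<gamma> s \<notin> interior K" by (simp add: frontier_def)
  then have "\<gamma> s \<notin> rel_interior K"
    using rel_interior_nonempty_interior nonempty_interior by blast
  then obtain v where v: "v \<noteq> 0" "\<And>b. b \<in> K \<Longrightarrow> inner v (\<gamma> s) \<le> inner v b"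
    using supporting_hyperplane_rel_boundary[OF convex curve_in] by metis
  define u where "u = - v"
  have u: "u \<noteq> 0" "\<And>b. b \<in> K \<Longrightarrow> inner b u \<le> inner (\<gamma> s) u"
    using v by (auto simp: u_def inner_commute)
  \<comment> \<open>Along the curve \<open>inner (\<gamma> x) u\<close> is maximal at
    \<open>s\<close>, so its derivative vanishes there and \<open>u\<close> is a multiple of the
    normal.\<close>
  have "inner (cis (\<theta> s)) u = 0"
    using DERIV_local_max[OF has_real_derivative_inner_const[OF tangent], of 1 s u] u(2) curve_in
    by simp
  then have orth: "cos (\<theta> s) * Re u + sin (\<theta> s) * Im u = 0"
    by (simp add: inner_complex_def)
  define r where "r = sin (\<theta> s) * Re u - cos (\<theta> s) * Im u"
  have "Re u = r * sin (\<theta> s)" "Im u = - (r * cos (\<theta> s))"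
    using orth sin_cos_squared_add[of "\<theta> s"] unfolding r_def by algebra+
  then have r: "u = r *\<^sub>R normal s"
    by (simp add: complex_eq_iff)
  have "r > 0"
  proof (rule ccontr)
    assume "\<not> r > 0"
    with r u(1) have neg: "r < 0" by (cases "r = 0") auto
    \<comment> \<open>For negative \<open>r\<close>, maximality would keep the whole curve on the
      side of the tangent line into which \<open>normal s\<close> points. When the angle has grown
      by \<open>pi\<close>, the curve is strictly on the other side.\<close>
    obtain t where t: "\<theta> t = \<theta> s + pi" using angle_surj by blast
    have st: "s < t" using t pi_gt_zero strict_mono_less[OF strict_mono_angle, of s t] by simp
    have "inner (\<gamma> t) (normal s) < inner (\<gamma> s) (normal s)"
    proof (rule DERIV_neg_imp_decreasing_open[OF st])
      fix x assume "s < x" "x < t"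
      then have "\<theta> s < \<theta> x" "\<theta> x < \<theta> s + pi"
        using strict_mono_angle t by (metis strict_mono_less)+
      then have "sin (\<theta> s - \<theta> x) < 0"
        using sin_gt_zero[of "\<theta> x - \<theta> s"] sin_minus[of "\<theta> x - \<theta> s"] by simp
      then show "\<exists>y. ((\<lambda>x. inner (\<gamma> x) (normal s)) has_real_derivative y) (at x) \<and> y < 0"
        using inner_normal_derivative by blast
    next
      show "continuous_on {s..t} (\<lambda>x. inner (\<gamma> x) (normal s))"
        using DERIV_isCont[OF inner_normal_derivative]
        by (intro continuous_at_imp_continuous_on ballI)
    qed
    moreover have "inner (\<gamma> t) u \<le> inner (\<gamma> s) u" using u(2) curve_in by blast
    then have "r * inner (\<gamma> t) (normal s) \<le> r * inner (\<gamma> s) (normal s)"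
      unfolding r inner_scaleR_right .
    ultimately show False using neg by (simp add: mult_le_cancel_left)
  qed
  moreover have "r * inner a (normal s) \<le> r * inner (\<gamma> s) (normal s)"
    using u(2)[OF assms] unfolding r inner_scaleR_right .
  ultimately have "inner a (normal s) \<le> inner (\<gamma> s) (normal s)"
    by (simp add: mult_le_cancel_left)
  then show ?thesis by (simp add: inner_diff_left)
qed

lemma rolling_monotone:
  assumes "\<bar>\<theta> t - \<theta> s\<bar> \<le> pi"
  shows "inner (\<gamma> s) (normal s) - 1 / \<kappa> \<le> inner (\<gamma> t) (normal s) - cos (\<theta> t - \<theta> s) / \<kappa>"
proof -
  \<comment> \<open>This is the coordinate along \<open>normal s\<close> of the disc centre
    \<open>\<gamma> x - normal x / \<kappa>\<close>, since
    \<open>inner (normal x) (normal s)\<close> is the cosine of the angle difference. As long as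
    that difference is at most \<open>pi\<close> in modulus, \<open>f\<close> falls before
    \<open>s\<close> and rises after it.\<close>
  define f where "f = (\<lambda>x. inner (\<gamma> x) (normal s) - cos (\<theta> x - \<theta> s) / \<kappa>)"
  have der: "(f has_real_derivative sin (\<theta> x - \<theta> s) * (\<theta>' x / \<kappa> - 1)) (at x)" for x
  proof -
    have "((\<lambda>x. cos (\<theta> x - \<theta> s) / \<kappa>) has_real_derivative - sin (\<theta> x - \<theta> s) * \<theta>' x / \<kappa>) (at x)"
      using pos by (auto intro!: derivative_eq_intros angle)
    from DERIV_diff[OF inner_normal_derivative this]
    have "(f has_real_derivative sin (\<theta> s - \<theta> x) - - sin (\<theta> x - \<theta> s) * \<theta>' x / \<kappa>) (at x)"
      unfolding f_def .
    moreover have "sin (\<theta> s - \<theta> x) = - sin (\<theta> x - \<theta> s)"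
      using sin_minus[of "\<theta> x - \<theta> s"] by simp
    ultimately show ?thesis by (simp add: right_diff_distrib)
  qed
  have factor: "\<theta>' x / \<kappa> - 1 \<ge> 0" for x
    using bound[of x] pos by simp
  have mono: "\<theta> x \<le> \<theta> y \<longleftrightarrow> x \<le> y" for x y
    using strict_mono_less_eq[OF strict_mono_angle] by blast
  have "f s \<le> f t"
  proof (cases "s \<le> t")
    case True
    then show ?thesis
    proof (rule DERIV_nonneg_imp_nondecreasing)
      fix x assume "s \<le> x" "x \<le> t"
      then have "sin (\<theta> x - \<theta> s) \<ge> 0"
        using assms mono[of s x] mono[of x t] by (intro sin_ge_zero) auto
      then show "\<exists>y. (f has_real_derivative y) (at x) \<and> 0 \<le> y"
        using der factor by (meson mult_nonneg_nonneg)
    qed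
  next
    case False
    then have "t \<le> s" by simp
    then show ?thesis
    proof (rule DERIV_nonpos_imp_nonincreasing)
      fix x assume "t \<le> x" "x \<le> s"
      then have "sin (- (\<theta> x - \<theta> s)) \<ge> 0"
        using assms mono[of t x] mono[of x s] by (intro sin_ge_zero) auto
      then have "sin (\<theta> x - \<theta> s) \<le> 0"
        unfolding sin_minus by linarith
      then show "\<exists>y. (f has_real_derivative y) (at x) \<and> y \<le> 0"
        using der factor by (meson mult_nonpos_nonneg)
    qed
  qed
  then show ?thesis by (simp add: f_def)
qed

theorem rolling:
  assumes "a \<in> K"
  shows "norm (a - (\<gamma> t - normal t / \<kappa>)) \<le> 1 / \<kappa>"
proof (cases "a = \<gamma> t - normal t / \<kappa>")
  case True
  then show ?thesis using pos by simp
next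
  case False
  define w where "w = a - (\<gamma> t - normal t / \<kappa>)"
  \<comment> \<open>The angle from \<open>normal t\<close> to \<open>w\<close>, as dividing by
    \<open>normal t\<close> is multiplying by \<open>\<i> / cis (\<theta> t)\<close>. The principal
    value lies within \<open>pi\<close> of 0, as \<open>rolling_monotone\<close> requires, and
    \<open>normal s\<close> becomes the unit vector along \<open>w\<close>.\<close>
  define \<phi> where "\<phi> = Arg (w * \<i> / cis (\<theta> t))"
  obtain s where s: "\<theta> s = \<theta> t + \<phi>" using angle_surj by blast
  have "\<bar>\<theta> t - \<theta> s\<bar> \<le> pi"
    using Arg_bounded[of "w * \<i> / cis (\<theta> t)"] by (auto simp: s \<phi>_def)
  note roll = rolling_monotone[OF this]
  have "w * \<i> / cis (\<theta> t) = norm w * cis \<phi>"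
    unfolding \<phi>_def using Arg_eq[of "w * \<i> / cis (\<theta> t)"] False
    by (simp add: w_def norm_mult norm_divide cis_conv_exp)
  then have "w * \<i> = norm w * cis (\<theta> s)"
    unfolding s by (simp add: field_simps flip: cis_mult)
  then have "- \<i> * (w * \<i>) = - \<i> * (norm w * cis (\<theta> s))"
    by simp
  then have w: "w = norm w *\<^sub>R normal s"
    by (simp add: scaleR_conv_of_real algebra_simps)
  have "inner (normal s) (normal s) = 1"
    by (simp add: inner_complex_def flip: power2_eq_square)
  then have "norm w = inner w (normal s)"
    by (metis w inner_scaleR_left mult.right_neutral)
  \<comment> \<open>The detour through \<open>\<gamma> s\<close> splits the projection: the
    supporting line at \<open>s\<close> makes the first term nonpositive, and \<open>roll\<close>
    bounds the rest.\<close>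
  also have "\<dots> = inner (a - \<gamma> s) (normal s) + inner (\<gamma> s) (normal s) - inner (\<gamma> t) (normal s)
      + cos (\<theta> t - \<theta> s) / \<kappa>"
    using pos by (simp add: w_def inner_complex_def field_simps cos_diff)
  also have "\<dots> \<le> 1 / \<kappa>"
    using supporting_line[OF assms, of s] roll by linarith
  finally show ?thesis by (simp add: w_def)
qed

end

section \<open>The inverse Markov inequality\<close>

text \<open>The disc about \<open>N / \<kappa>\<close> has 0 on its boundary circle, so inversion
  turns it into a half-plane. Expanding the square of the norm gives the half-plane
  explicitly.\<close>

lemma Re_normal_div_ge:
  fixes w N :: complex
  assumes "norm (w - N / \<kappa>) \<le> 1 / \<kappa>" and "norm N = 1" and "\<kappa> > 0" and "w \<noteq> 0"
  shows "Re (N / w) \<ge> \<kappa> / 2"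
proof -
  have "(norm (w - N / \<kappa>))\<^sup>2 \<le> (1 / \<kappa>)\<^sup>2"
    using assms(1) by (intro power_mono) auto
  moreover have "(norm (w - N / \<kappa>))\<^sup>2 = (norm w)\<^sup>2 - 2 * inner N w / \<kappa> + (norm N)\<^sup>2 / \<kappa>\<^sup>2"
    unfolding cmod_power2 using assms(3)
    by (simp add: inner_complex_def power2_eq_square field_simps)
  ultimately have "(norm w)\<^sup>2 \<le> 2 * inner N w / \<kappa>"
    using assms(2) by (simp add: power_divide)
  then have "\<kappa> / 2 * (norm w)\<^sup>2 \<le> inner N w"
    using assms(3) by (simp add: field_simps)
  moreover have "Re (N / w) = inner N w / (norm w)\<^sup>2"
    by (simp add: Re_divide inner_complex_def cmod_power2)
  ultimately show ?thesis
    using assms(4) by (simp add: pos_le_divide_eq)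
qed

text \<open>The logarithmic derivative is the sum of \<open>1 / (z - a)\<close> over the zeros with
  multiplicity; the induction splits off one linear factor at a time.\<close>

lemma Re_logarithmic_derivative_ge:
  fixes p :: "complex poly"
  assumes "poly p z \<noteq> 0" and "\<And>a. poly p a = 0 \<Longrightarrow> Re (N / (z - a)) \<ge> c"
  shows "Re (N * poly (pderiv p) z / poly p z) \<ge> c * degree p"
  using assms
proof (induction "degree p" arbitrary: p)
  case 0
  then obtain k where "p = [:k:]" by (metis degree_eq_zeroE)
  then show ?case by (simp add: pderiv_pCons)
next
  case (Suc m)
  obtain a where a: "poly p a = 0"
    using Suc.hyps(2) alg_closed_imp_poly_has_root[of p] by auto
  then obtain q where q: "p = [:- a, 1:] * q"
    by (metis dvdE poly_eq_0_iff_dvd)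
  have "q \<noteq> 0" using q Suc.prems(1) by auto
  then have deg: "degree p = Suc (degree q)"
    unfolding q by (subst degree_mult_eq) auto
  have nz: "z - a \<noteq> 0" "poly q z \<noteq> 0"
    using Suc.prems(1) by (auto simp: q)
  have "Re (N * poly (pderiv q) z / poly q z) \<ge> c * degree q"
    using Suc.hyps deg nz Suc.prems(2) by (intro Suc.hyps(1)) (auto simp: q)
  moreover have "N * poly (pderiv p) z / poly p z = N / (z - a) + N * poly (pderiv q) z / poly q z"
    using nz unfolding q pderiv_mult by (simp add: pderiv_pCons field_simps)
  ultimately show ?case
    using Suc.prems(2)[OF a] deg by (simp add: algebra_simps)
qed

lemma norm_poly_le_poly_norm:
  assumes "compact K" and "z \<in> K"
  shows "norm (poly q z) \<le> poly_norm K q"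
  unfolding poly_norm_def
proof (rule cSUP_upper[OF assms(2)])
  have "compact ((\<lambda>z. norm (poly q z)) ` K)"
    using assms(1) by (intro compact_continuous_image continuous_intros)
  then show "bdd_above ((\<lambda>z. norm (poly q z)) ` K)"
    by (simp add: bounded_imp_bdd_above compact_imp_bounded)
qed

text \<open>By the maximum modulus principle the extremal point can be taken on the curve, where a
  tangent disc is available.\<close>

lemma poly_norm_attained_frontier:
  assumes "compact K" and "K \<noteq> {}"
  obtains z where "z \<in> frontier K" and "norm (poly q z) = poly_norm K q"
proof -
  have fr: "frontier K \<noteq> {}" "compact (frontier K)" "frontier K \<subseteq> K"
    using assms frontier_not_empty[of K] compact_imp_bounded[of K] compact_frontier
      frontier_subset_compact not_bounded_UNIV[where 'a = complex] by blast+
  have "continuous_on (frontier K) (\<lambda>z. norm (poly q z))"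
    by (intro continuous_intros)
  then obtain z where z: "z \<in> frontier K"
    "\<And>w. w \<in> frontier K \<Longrightarrow> norm (poly q w) \<le> norm (poly q z)"
    using continuous_attains_sup[OF fr(2,1)] by blast
  have "norm (poly q w) \<le> norm (poly q z)" if "w \<in> K" for w
  proof (rule maximum_modulus_frontier[of "poly q" K])
    show "poly q holomorphic_on interior K" "continuous_on (closure K) (poly q)"
      by (intro holomorphic_intros holomorphic_on_id continuous_intros)+
  qed (use z(2) assms(1) that in \<open>auto simp: compact_imp_bounded\<close>)
  then have "poly_norm K q \<le> norm (poly q z)"
    unfolding poly_norm_def using assms(2) by (intro cSUP_least) auto
  moreover have "norm (poly q z) \<le> poly_norm K q"
    using norm_poly_le_poly_norm[OF assms(1)] z(1) fr(3) by blast
  ultimately show ?thesis using that z(1) by force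
qed

theorem theorem1:
  fixes K :: "complex set" and \<gamma> :: "real \<Rightarrow> complex" and L \<kappa> :: real and n :: nat
  assumes "convex_domain K"
    and "positive_arc_length_param K L \<gamma>"
    and "C2_curve \<gamma>"
    and "\<kappa> > 0"
    and "\<forall>s. curvature \<gamma> s \<ge> \<kappa>"
    and "n > 0"
  shows "inverse_markov n K \<ge> \<kappa> / 2 * real n"
proof -
  have K: "compact K" "convex K" "interior K \<noteq> {}"
    using assms(1) by (auto simp: convex_domain_def)
  have "K \<noteq> {}" using K(3) interior_subset by auto
  have \<gamma>: "range \<gamma> = frontier K" "\<And>s. norm (vector_derivative \<gamma> (at s)) = 1"
    using assms(2) by (auto simp: positive_arc_length_param_def)
  obtain \<theta> where \<theta>: "\<And>s. (\<gamma> has_vector_derivative cis (\<theta> s)) (at s)"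
    "\<And>s. (\<theta> has_real_derivative curvature \<gamma> s) (at s)"
    using tangent_angle_with_curvature[OF assms(3) \<gamma>(2)] by blast
  interpret strictly_curved K \<gamma> \<theta> "curvature \<gamma>" \<kappa>
    using K \<gamma> \<theta> assms(4,5) by unfold_locales (auto simp: compact_imp_closed)
  have main: "\<kappa> / 2 * real n \<le> poly_norm K (pderiv p) / poly_norm K p"
    if "p \<in> polys_zeros_in n K" for p
  proof -
    have p: "p \<noteq> 0" "degree p = n" "\<And>a. poly p a = 0 \<Longrightarrow> a \<in> K"
      using that by (auto simp: polys_zeros_in_def)
    obtain z where z: "z \<in> frontier K" "norm (poly p z) = poly_norm K p"
      using poly_norm_attained_frontier[OF K(1) \<open>K \<noteq> {}\<close>] by blast
    then obtain s where s: "z = \<gamma> s" using \<gamma>(1) by blast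
    \<comment> \<open>Otherwise the maximum is 0 and \<open>p\<close> vanishes on all of
      \<open>K\<close>, which is infinite because its interior is nonempty.\<close>
    have "poly p z \<noteq> 0"
    proof
      assume "poly p z = 0"
      then have "poly p w = 0" if "w \<in> K" for w
        using norm_poly_le_poly_norm[OF K(1) that, of p] z(2) by simp
      then have "K \<subseteq> {w. poly p w = 0}" by blast
      then have "finite K" using poly_roots_finite[OF p(1)] finite_subset by blast
      then show False using K(3) using empty_interior_finite by blast
    qed
    have "Re (normal s / (z - a)) \<ge> \<kappa> / 2" if "poly p a = 0" for a
    proof (rule Re_normal_div_ge)
      \<comment> \<open>The map from \<open>a\<close> to \<open>z - a\<close> carries the tangent
        disc at \<open>z\<close> to the disc about \<open>normal s / \<kappa>\<close> through
        0.\<close>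
      have "norm (z - a - normal s / \<kappa>) = norm (a - (\<gamma> s - normal s / \<kappa>))"
        unfolding s by (subst norm_minus_commute) (simp add: algebra_simps)
      then show "norm (z - a - normal s / \<kappa>) \<le> 1 / \<kappa>"
        using rolling[OF p(3)[OF that], of s] by simp
      show "z - a \<noteq> 0" using that \<open>poly p z \<noteq> 0\<close> by auto
    qed (use pos in \<open>auto simp: norm_mult\<close>)
    then have "\<kappa> / 2 * real n \<le> Re (normal s * poly (pderiv p) z / poly p z)"
      using Re_logarithmic_derivative_ge[OF \<open>poly p z \<noteq> 0\<close>] p(2) by metis
    also have "\<dots> \<le> norm (normal s * poly (pderiv p) z / poly p z)"
      by (rule complex_Re_le_cmod)
    also have "\<dots> = norm (poly (pderiv p) z) / poly_norm K p"
      by (simp add: norm_mult norm_divide z(2))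
    also have "\<dots> \<le> poly_norm K (pderiv p) / poly_norm K p"
      using norm_poly_le_poly_norm[OF K(1)] curve_in z(2) s
      by (intro divide_right_mono) (metis, metis norm_ge_zero)
    finally show ?thesis .
  qed
  \<comment> \<open>A lower bound passes to \<open>INF\<close> over the reals only for a nonempty
    index set; a power of a linear factor is a member.\<close>
  obtain a where "a \<in> K" using \<open>K \<noteq> {}\<close> by blast
  then have "[:- a, 1:] ^ n \<in> polys_zeros_in n K"
    by (auto simp: polys_zeros_in_def degree_power_eq)
  then show ?thesis
    unfolding inverse_markov_def using main by (intro cINF_greatest) auto
qed

end
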